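(* Let $\Phi_r$ be a time reparameterization of $\Phi$ with an associated uniformly bounded positive function $r\colon M\to\mathbb{R}_{>0}$. For $\mu\in\mathcal{M}(\Phi)$ and $\mu_r$ given by $d\mu_r=\frac{r}{\int_M r\,d\mu}\,d\mu$, we have $$\underline D_q(\mu_r)=\underline D_q(\mu)\quad\text{and}\quad\overline D_q(\mu_r)=\overline D_q(\mu)\qquad\text{for every }q>0,\ q\neq1 .$$
   Context: Setting. $M$ is a manifold of class $C^m$, $m\ge 2$, with a Riemannian metric of class $C^{m-1}$ and induced distance $\rho$. $f$ is a $C^\ell$ vector field on $M$, $1\le \ell<m$, such that $dx/dt=f(x)$ generates a $C^\ell$ flow $\Phi=\{\varphi^t\}_{t\in\mathbb{R}}$. A $C^\ell$ flow $\Phi_r=\{\varphi^\tau_r\}_{\tau\in\mathbb{R}}$ on $M$ is a time reparameterization of $\Phi$ with associated function $r$ if for every $x$ the orbits of $x$ under both flows coincide with the same orientation and times are related by $d\tau=r(x)\,dt$. That is, $\varphi_r^{\tau(x,t)}(x)=\varphi^t(x)$ with $\tau(x,t)=\int_0^tr(\varphi^s(x))\,ds$. $\mathcal M(\Phi)$ is the set of $\Phi$-invariant Borel probability measures on $M$. Generalized dimensions. For a Borel probability measure $\nu$ on $M$, $q>0$, $q\ne1$, and $B(x,\varepsilon)=\{z:\rho(x,z)<\varepsilon\}$, $$\underline D_q(\nu)=\frac1{q-1}\liminf_{\varepsilon\to0}\frac{1}{\log\varepsilon}\log\int_M\nu(B(x,\varepsilon))^{q-1}\,d\nu(x),$$ and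 $\overline D_q(\nu)$ is defined analogously with the upper limit in place of the lower limit.
   Formalization: "Uniformly bounded positive" is taken to mean that r is measurable and bounded above and also bounded away from zero (0 < a ≤ r ≤ b); with only an upper bound the claim fails on non-compact M, e.g. for the zero vector field on the plane. *)

theory Defs
  imports "HOL-Analysis.Analysis" "HOL-Probability.Probability"
begin

section \<open>Manifolds of class $C^m$ with a Riemannian metric\<close>

text \<open>
  Class $C^k$ on an open set, by iterated directional derivatives. Between finite-dimensional
  spaces this is the usual notion. It is only meant for open sets \<open>S\<close>.
\<close>

fun Ck_on :: "nat \<Rightarrow> ('a::real_normed_vector \<Rightarrow> 'b::real_normed_vector) \<Rightarrow> 'a set \<Rightarrow> bool" where
  "Ck_on 0 h S \<longleftrightarrow> continuous_on S h"
| "Ck_on (Suc k) h S \<longleftrightarrow>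
     (\<forall>x\<in>S. h differentiable (at x)) \<and>
     (\<forall>v. Ck_on k (\<lambda>x. frechet_derivative h (at x) v) S)"

text \<open>
  The manifold is the universe of a Hausdorff, second countable type \<open>'a\<close>, modelled on the
  Euclidean space \<open>'e\<close>. A chart is a domain together with a coordinate map, whose values
  outside the domain are irrelevant.
\<close>

type_synonym ('a, 'e) chart = "'a set \<times> ('a \<Rightarrow> 'e)"

abbreviation cdom :: "('a, 'e) chart \<Rightarrow> 'a set" where "cdom c \<equiv> fst c"
abbreviation coord :: "('a, 'e) chart \<Rightarrow> 'a \<Rightarrow> 'e" where "coord c \<equiv> snd c"
abbreviation coord_inv :: "('a, 'e) chart \<Rightarrow> 'e \<Rightarrow> 'a" where
  "coord_inv c \<equiv> inv_into (cdom c) (coord c)"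

definition Ck_manifold ::
  "nat \<Rightarrow> ('a::{t2_space,second_countable_topology}, 'e::euclidean_space) chart set \<Rightarrow> bool" where
  "Ck_manifold m A \<longleftrightarrow>
     (\<Union>c\<in>A. cdom c) = UNIV \<and>
     (\<forall>c\<in>A. open (cdom c) \<and> open (coord c ` cdom c) \<and>
        homeomorphism (cdom c) (coord c ` cdom c) (coord c) (coord_inv c)) \<and>
     (\<forall>c\<in>A. \<forall>d\<in>A. Ck_on m (coord d \<circ> coord_inv c) (coord c ` (cdom c \<inter> cdom d)))"

text \<open>Derivative at \<open>p\<close> of the change of coordinates from \<open>c\<close> to \<open>d\<close>.\<close>

definition transition_deriv ::
  "('a, 'e::euclidean_space) chart \<Rightarrow> ('a, 'e) chart \<Rightarrow> 'a \<Rightarrow> 'e \<Rightarrow> 'e" where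
  "transition_deriv c d p = frechet_derivative (coord d \<circ> coord_inv c) (at (coord c p))"

text \<open>
  Tensor fields are given by their components in every chart, subject to the transformation law:
  \<open>G c p v w\<close> is the inner product, and \<open>f c p\<close> the vector, at \<open>p\<close> in the coordinates \<open>c\<close>.
\<close>

definition Ck_riemannian_metric ::
  "nat \<Rightarrow> ('a, 'e::euclidean_space) chart set \<Rightarrow>
   (('a, 'e) chart \<Rightarrow> 'a \<Rightarrow> 'e \<Rightarrow> 'e \<Rightarrow> real) \<Rightarrow> bool" where
  "Ck_riemannian_metric k A G \<longleftrightarrow>
     (\<forall>c\<in>A. \<forall>p\<in>cdom c. bilinear (G c p) \<and> (\<forall>v w. G c p v w = G c p w v) \<and>
        (\<forall>v. v \<noteq> 0 \<longrightarrow> G c p v v > 0)) \<and>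
     (\<forall>c\<in>A. \<forall>v w. Ck_on k (\<lambda>u. G c (coord_inv c u) v w) (coord c ` cdom c)) \<and>
     (\<forall>c\<in>A. \<forall>d\<in>A. \<forall>p\<in>cdom c \<inter> cdom d. \<forall>v w.
        G c p v w = G d p (transition_deriv c d p v) (transition_deriv c d p w))"

definition Ck_vector_field ::
  "nat \<Rightarrow> ('a, 'e::euclidean_space) chart set \<Rightarrow> (('a, 'e) chart \<Rightarrow> 'a \<Rightarrow> 'e) \<Rightarrow> bool" where
  "Ck_vector_field k A f \<longleftrightarrow>
     (\<forall>c\<in>A. Ck_on k (\<lambda>u. f c (coord_inv c u)) (coord c ` cdom c)) \<and>
     (\<forall>c\<in>A. \<forall>d\<in>A. \<forall>p\<in>cdom c \<inter> cdom d. f d p = transition_deriv c d p (f c p))"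

definition C1_curve_on ::
  "('a::topological_space, 'e::euclidean_space) chart set \<Rightarrow> (real \<Rightarrow> 'a) \<Rightarrow> real \<Rightarrow> real \<Rightarrow> bool" where
  "C1_curve_on A \<gamma> a b \<longleftrightarrow>
     continuous_on {a..b} \<gamma> \<and>
     (\<forall>c\<in>A.
        (\<forall>t\<in>{a..b} \<inter> \<gamma> -` cdom c. (coord c \<circ> \<gamma>) differentiable (at t within {a..b})) \<and>
        continuous_on ({a..b} \<inter> \<gamma> -` cdom c)
          (\<lambda>t. vector_derivative (coord c \<circ> \<gamma>) (at t within {a..b})))"

definition piecewise_C1_curve ::
  "('a::topological_space, 'e::euclidean_space) chart set \<Rightarrow> (real \<Rightarrow> 'a) \<Rightarrow> bool" where
  "piecewise_C1_curve A \<gamma> \<longleftrightarrow>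
     (\<exists>(n::nat) p. p 0 = 0 \<and> p n = 1 \<and>
        (\<forall>i<n. p i < p (Suc i) \<and> C1_curve_on A \<gamma> (p i) (p (Suc i))))"

text \<open>
  By the transformation law the speed does not depend on the chart. It is unspecified at the
  finitely many breakpoints of a piecewise $C^1$ curve, which do not affect the length.
\<close>

definition curve_speed ::
  "('a, 'e::euclidean_space) chart set \<Rightarrow> (('a, 'e) chart \<Rightarrow> 'a \<Rightarrow> 'e \<Rightarrow> 'e \<Rightarrow> real) \<Rightarrow>
   (real \<Rightarrow> 'a) \<Rightarrow> real \<Rightarrow> real" where
  "curve_speed A G \<gamma> t =
     (let c = (SOME c. c \<in> A \<and> \<gamma> t \<in> cdom c);
          v = vector_derivative (coord c \<circ> \<gamma>) (at t)
      in sqrt (G c (\<gamma> t) v v))"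

definition curve_length ::
  "('a, 'e::euclidean_space) chart set \<Rightarrow> (('a, 'e) chart \<Rightarrow> 'a \<Rightarrow> 'e \<Rightarrow> 'e \<Rightarrow> real) \<Rightarrow>
   (real \<Rightarrow> 'a) \<Rightarrow> real" where
  "curve_length A G \<gamma> = integral {0..1} (curve_speed A G \<gamma>)"

text \<open>The value is \<open>\<infinity>\<close> exactly when the points lie in different components.\<close>

definition riemannian_dist ::
  "('a::topological_space, 'e::euclidean_space) chart set \<Rightarrow>
   (('a, 'e) chart \<Rightarrow> 'a \<Rightarrow> 'e \<Rightarrow> 'e \<Rightarrow> real) \<Rightarrow> 'a \<Rightarrow> 'a \<Rightarrow> ennreal" where
  "riemannian_dist A G x y =
     (INF \<gamma>\<in>{\<gamma>. piecewise_C1_curve A \<gamma> \<and> \<gamma> 0 = x \<and> \<gamma> 1 = y}. ennreal (curve_length A G \<gamma>))"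


section \<open>Flows and time reparameterizations\<close>

definition Ck_flow ::
  "nat \<Rightarrow> ('a::topological_space, 'e::euclidean_space) chart set \<Rightarrow> (real \<Rightarrow> 'a \<Rightarrow> 'a) \<Rightarrow> bool" where
  "Ck_flow k A \<phi> \<longleftrightarrow>
     (\<forall>x. \<phi> 0 x = x) \<and> (\<forall>s t x. \<phi> (s + t) x = \<phi> s (\<phi> t x)) \<and>
     continuous_on UNIV (\<lambda>(t, x). \<phi> t x) \<and>
     (\<forall>c\<in>A. \<forall>d\<in>A. Ck_on k (\<lambda>(t, u). coord d (\<phi> t (coord_inv c u)))
        {(t, u). u \<in> coord c ` cdom c \<and> \<phi> t (coord_inv c u) \<in> cdom d})"

definition generates_flow ::
  "('a, 'e::euclidean_space) chart set \<Rightarrow> (('a, 'e) chart \<Rightarrow> 'a \<Rightarrow> 'e) \<Rightarrow>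
   (real \<Rightarrow> 'a \<Rightarrow> 'a) \<Rightarrow> bool" where
  "generates_flow A f \<phi> \<longleftrightarrow>
     (\<forall>x t. \<forall>c\<in>A. \<phi> t x \<in> cdom c \<longrightarrow>
        ((\<lambda>s. coord c (\<phi> s x)) has_vector_derivative f c (\<phi> t x)) (at t))"

text \<open>$\tau(x,t)=\int_0^t r(\varphi^s(x))\,ds$, with the usual sign for negative \<open>t\<close>.\<close>

definition reparam_time :: "(real \<Rightarrow> 'a \<Rightarrow> 'a) \<Rightarrow> ('a \<Rightarrow> real) \<Rightarrow> 'a \<Rightarrow> real \<Rightarrow> real" where
  "reparam_time \<phi> r x t = interval_lebesgue_integral lborel 0 (ereal t) (\<lambda>s. r (\<phi> s x))"

text \<open>
  Positivity of \<open>r\<close> makes \<open>reparam_time \<phi> r x\<close> increasing, so that the common orbits carry the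
  same orientation.
\<close>

definition time_reparameterization ::
  "nat \<Rightarrow> ('a::topological_space, 'e::euclidean_space) chart set \<Rightarrow> (real \<Rightarrow> 'a \<Rightarrow> 'a) \<Rightarrow>
   ('a \<Rightarrow> real) \<Rightarrow> (real \<Rightarrow> 'a \<Rightarrow> 'a) \<Rightarrow> bool" where
  "time_reparameterization k A \<phi> r \<phi>\<^sub>r \<longleftrightarrow>
     Ck_flow k A \<phi>\<^sub>r \<and> (\<forall>x. r x > 0) \<and>
     (\<forall>x. range (\<lambda>t. \<phi>\<^sub>r t x) = range (\<lambda>t. \<phi> t x)) \<and>
     (\<forall>x t. interval_lebesgue_integrable lborel 0 (ereal t) (\<lambda>s. r (\<phi> s x)) \<and>
        \<phi>\<^sub>r (reparam_time \<phi> r x t) x = \<phi> t x)"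

definition invariant_prob_measures ::
  "(real \<Rightarrow> 'a::topological_space \<Rightarrow> 'a) \<Rightarrow> 'a measure set" where
  "invariant_prob_measures \<phi> =
     {\<mu>. sets \<mu> = sets borel \<and> prob_space \<mu> \<and>
         (\<forall>t. \<forall>B\<in>sets borel. emeasure \<mu> (\<phi> t -` B) = emeasure \<mu> B)}"

definition reparam_measure :: "('a \<Rightarrow> real) \<Rightarrow> 'a measure \<Rightarrow> 'a measure" where
  "reparam_measure r \<mu> = density \<mu> (\<lambda>x. ennreal (r x / (\<integral>y. r y \<partial>\<mu>)))"


section \<open>Generalized dimensions\<close>

text \<open>
  On a non-compact manifold the correlation integral may be infinite for \<open>q < 1\<close>, so logarithm
  and power take extended values, with $\log 0=-\infty$, $\log\infty=\infty$ and $0^s=\infty$ for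
  \<open>s < 0\<close>.
\<close>

definition ennreal_ln :: "ennreal \<Rightarrow> ereal" where
  "ennreal_ln a = (if a = 0 then - \<infinity> else if a = \<infinity> then \<infinity> else ereal (ln (enn2real a)))"

definition prob_powr :: "real \<Rightarrow> real \<Rightarrow> ennreal" where
  "prob_powr a s = (if a = 0 \<and> s < 0 then \<infinity> else ennreal (a powr s))"

definition correlation_integral ::
  "('a \<Rightarrow> 'a \<Rightarrow> ennreal) \<Rightarrow> real \<Rightarrow> 'a measure \<Rightarrow> real \<Rightarrow> ennreal" where
  "correlation_integral \<rho> q \<nu> \<epsilon> =
     (\<integral>\<^sup>+ x. prob_powr (measure \<nu> {z. \<rho> x z < ennreal \<epsilon>}) (q - 1) \<partial>\<nu>)"

definition lower_dim :: "('a \<Rightarrow> 'a \<Rightarrow> ennreal) \<Rightarrow> real \<Rightarrow> 'a measure \<Rightarrow> ereal" where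
  "lower_dim \<rho> q \<nu> = ereal (1 / (q - 1)) *
     Liminf (at_right 0) (\<lambda>\<epsilon>. ereal (1 / ln \<epsilon>) * ennreal_ln (correlation_integral \<rho> q \<nu> \<epsilon>))"

definition upper_dim :: "('a \<Rightarrow> 'a \<Rightarrow> ennreal) \<Rightarrow> real \<Rightarrow> 'a measure \<Rightarrow> ereal" where
  "upper_dim \<rho> q \<nu> = ereal (1 / (q - 1)) *
     Limsup (at_right 0) (\<lambda>\<epsilon>. ereal (1 / ln \<epsilon>) * ennreal_ln (correlation_integral \<rho> q \<nu> \<epsilon>))"

end

theory Submission
  imports Defs
begin

text \<open>
  The density \<open>r / \<integral> r d\<mu>\<close> is bounded above and away from zero, so the two measures dominate each
  other up to a constant \<open>C \<ge> 1\<close>. Replacing one measure by the other changes the mass of each ball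
  by a factor in \<open>[1/C, C]\<close>, hence the \<open>(q - 1)\<close>-th power of that mass by a factor of at most
  \<open>C powr \<bar>q - 1\<bar>\<close> (whatever the sign of \<open>q - 1\<close>), and the measure used for the outer integration
  costs one more factor \<open>C\<close>. So the correlation integrals at scale \<open>\<epsilon>\<close> are comparable with a
  constant that is independent of \<open>\<epsilon>\<close> (\<open>correlation_integral_le_of_comparable\<close>). Taking logarithms
  turns this constant into a bounded additive error, which disappears in the limit after division by
  \<open>ln \<epsilon>\<close> (\<open>dims_eq_of_comparable\<close>).

  The comparison is made for an arbitrary \<open>\<rho>\<close>, for which balls, and the mass of a ball as a function
  of its centre, may fail to be measurable. A set that is not measurable has measure zero for both measures, so the comparison of masses
  persists, and the outer integral is compared as a lower integral, through simple functions
  (\<open>nn_integral_le_of_dominated\<close>).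
\<close>

section \<open>Comparable measures have comparable correlation integrals\<close>

text \<open>
  The integral of a function \<open>f\<close> that may fail to be measurable is the supremum over the simple
  functions below \<open>f\<close>. For these, the measure and the constant \<open>K\<close> can be exchanged separately.
\<close>

lemma nn_integral_le_of_dominated:
  assumes sets: "sets M = sets N"
    and dom: "\<And>B. B \<in> sets N \<Longrightarrow> emeasure M B \<le> ennreal C * emeasure N B"
    and K: "K > 0"
    and le: "\<And>x. f x \<le> ennreal K * g x"
  shows "(\<integral>\<^sup>+x. f x \<partial>M) \<le> ennreal C * ennreal K * (\<integral>\<^sup>+x. g x \<partial>N)"
  unfolding nn_integral_def[of M f]
proof (rule SUP_least)
  fix u assume "u \<in> {u. simple_function M u \<and> u \<le> f}"
  then have u: "simple_function M u" and uf: "\<And>x. u x \<le> f x"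
    by (auto simp: le_fun_def)
  have uN: "simple_function N u"
    using u sets sets_eq_imp_space_eq[OF sets] by (simp add: simple_function_def)
  have meas: "u \<in> borel_measurable N"
    using uN by (rule borel_measurable_simple_function)
  have inv: "ennreal (1/K) * ennreal K = 1"
    using K by (simp flip: ennreal_mult)
  have "simple_integral M u \<le> ennreal C * simple_integral N u"
    unfolding simple_integral_def sum_distrib_left sets_eq_imp_space_eq[OF sets]
  proof (rule sum_mono)
    fix y assume "y \<in> u ` space N"
    have "u -` {y} \<inter> space N \<in> sets N"
      using uN by (rule simple_functionD)
    then show "y * emeasure M (u -` {y} \<inter> space N)
        \<le> ennreal C * (y * emeasure N (u -` {y} \<inter> space N))"
      using mult_left_mono[OF dom, of "u -` {y} \<inter> space N" y] by (simp add: ac_simps)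
  qed
  also have "simple_integral N u = (\<integral>\<^sup>+x. ennreal K * (ennreal (1/K) * u x) \<partial>N)"
    using nn_integral_eq_simple_integral[OF uN] inv
    by (simp add: mult.assoc[symmetric] mult.commute[of "ennreal K"])
  also have "\<dots> = ennreal K * (\<integral>\<^sup>+x. ennreal (1/K) * u x \<partial>N)"
    using meas by (intro nn_integral_cmult) measurable
  also have "(\<integral>\<^sup>+x. ennreal (1/K) * u x \<partial>N) \<le> (\<integral>\<^sup>+x. g x \<partial>N)"
  proof (rule nn_integral_mono)
    fix x
    have "ennreal (1/K) * u x \<le> ennreal (1/K) * (ennreal K * g x)"
      by (intro mult_left_mono order.trans[OF uf le]) simp
    also have "\<dots> = g x"
      using inv by (simp add: mult.assoc[symmetric])
    finally show "ennreal (1/K) * u x \<le> g x" .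
  qed
  finally show "simple_integral M u \<le> ennreal C * ennreal K * (\<integral>\<^sup>+x. g x \<partial>N)"
    by (simp add: mult.assoc mult_left_mono)
qed

text \<open>
  Both inequalities between \<open>a\<close> and \<open>b\<close> are needed, the power being decreasing for \<open>s < 0\<close>; they
  also force \<open>a\<close> and \<open>b\<close> to vanish together, which matters where the power is infinite.
\<close>

lemma prob_powr_le_of_comparable:
  assumes "0 \<le> a" "0 \<le> b" and C: "C > 0" and ab: "a \<le> C * b" and ba: "b \<le> C * a"
  shows "prob_powr a s \<le> ennreal (C powr \<bar>s\<bar>) * prob_powr b s"
proof (cases "a = 0")
  case True
  with assms have "b = 0" by simp
  with True C show ?thesis by (simp add: prob_powr_def ennreal_mult_top)
next
  case False
  with assms have pos: "a > 0" "b > 0"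
    by (auto simp: less_le)
  have "a powr s \<le> C powr \<bar>s\<bar> * b powr s"
  proof (cases "s \<ge> 0")
    case True
    then have "a powr s \<le> (C * b) powr s"
      using pos ab by (intro powr_mono2) auto
    with True pos C show ?thesis by (simp add: powr_mult)
  next
    case False
    have "b / C \<le> a"
      using ba C by (simp add: field_simps)
    then have "a powr s \<le> (b / C) powr s"
      using pos C False by (intro powr_mono2') auto
    with False pos C show ?thesis by (simp add: powr_divide powr_minus field_simps)
  qed
  then show ?thesis
    using pos by (simp add: prob_powr_def flip: ennreal_mult)
qed

lemma correlation_integral_le_of_comparable:
  assumes "finite_measure M" "finite_measure N" and sets: "sets M = sets N" and C: "C > 0"
    and MN: "\<And>B. B \<in> sets N \<Longrightarrow> emeasure M B \<le> ennreal C * emeasure N B"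
    and NM: "\<And>B. B \<in> sets N \<Longrightarrow> emeasure N B \<le> ennreal C * emeasure M B"
  shows "correlation_integral \<rho> q M \<epsilon>
    \<le> ennreal (C * C powr \<bar>q - 1\<bar>) * correlation_integral \<rho> q N \<epsilon>"
proof -
  interpret M: finite_measure M by fact
  interpret N: finite_measure N by fact
  have meas: "measure M B \<le> C * measure N B \<and> measure N B \<le> C * measure M B" for B
  proof (cases "B \<in> sets N")
    case True
    with MN[of B] NM[of B] C show ?thesis
      by (simp add: M.emeasure_eq_measure N.emeasure_eq_measure flip: ennreal_mult)
  next
    case False
    with sets show ?thesis by (simp add: measure_notin_sets)
  qed
  have "correlation_integral \<rho> q M \<epsilon>
      \<le> ennreal C * ennreal (C powr \<bar>q - 1\<bar>) * correlation_integral \<rho> q N \<epsilon>"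
    unfolding correlation_integral_def
  proof (rule nn_integral_le_of_dominated[OF sets MN])
    show "prob_powr (measure M {z. \<rho> x z < ennreal \<epsilon>}) (q - 1) \<le> ennreal (C powr \<bar>q - 1\<bar>) *
        prob_powr (measure N {z. \<rho> x z < ennreal \<epsilon>}) (q - 1)" for x
      using meas C by (intro prob_powr_le_of_comparable) auto
  qed (use C in auto)
  with C show ?thesis by (simp add: ennreal_mult)
qed

section \<open>Bounded factors do not affect the dimensions\<close>

lemma ennreal_ln_le_of_le_mult:
  assumes K: "K > 0" and le: "a \<le> ennreal K * b"
  shows "ennreal_ln a \<le> ereal (ln K) + ennreal_ln b"
proof (cases a)
  case (real x)
  show ?thesis
  proof (cases b)
    case b: (real y)
    show ?thesis
    proof (cases "x = 0")
      case True
      with real show ?thesis by (simp add: ennreal_ln_def)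
    next
      case False
      with real have x: "x > 0" by simp
      have xy: "x \<le> K * y"
        using le real b K by (simp flip: ennreal_mult)
      with x K have y: "y > 0"
        using zero_less_mult_pos[of K y] by linarith
      have "ln x \<le> ln K + ln y"
        using x xy y K by (simp flip: ln_mult_pos)
      with x y real b show ?thesis by (simp add: ennreal_ln_def)
    qed
  next
    case top
    then show ?thesis by (simp add: ennreal_ln_def)
  qed
next
  case top
  with le have "b = \<top>"
    by (auto simp: top_unique ennreal_mult_eq_top_iff)
  then show ?thesis by (simp add: ennreal_ln_def)
qed

text \<open>
  The sign of \<open>ln \<epsilon>\<close> reverses the inequality: an upper bound for \<open>I\<close> is a lower bound for the
  exponent.
\<close>

lemma log_ratio_le_of_le_mult:
  assumes K: "K > 0" and le: "\<And>\<epsilon>. I \<epsilon> \<le> ennreal K * J \<epsilon>" and e: "e > 0"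
  shows "\<forall>\<^sub>F \<epsilon> in at_right 0.
    ereal (1 / ln \<epsilon>) * ennreal_ln (J \<epsilon>) \<le> ereal (1 / ln \<epsilon>) * ennreal_ln (I \<epsilon>) + ereal e"
proof -
  have "((\<lambda>\<epsilon>::real. - ln K / ln \<epsilon>) \<longlongrightarrow> 0) (at_right 0)"
    by (intro tendsto_divide_0[OF tendsto_const] filterlim_at_bot_imp_at_infinity ln_at_0)
  then have "\<forall>\<^sub>F \<epsilon>::real in at_right 0. - ln K / ln \<epsilon> < e"
    using e by (rule order_tendstoD)
  moreover have "\<forall>\<^sub>F \<epsilon>::real in at_right 0. 0 < \<epsilon> \<and> \<epsilon> < 1"
    by (auto simp: eventually_at_right_field intro!: exI[of _ 1])
  ultimately show ?thesis
  proof eventually_elim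
    case (elim \<epsilon>)
    then have neg: "1 / ln \<epsilon> < 0" and small: "- (1 / ln \<epsilon>) * ln K < e"
      by (auto simp: ln_less_zero)
    have "ennreal_ln (I \<epsilon>) \<le> ereal (ln K) + ennreal_ln (J \<epsilon>)"
      using K le by (rule ennreal_ln_le_of_le_mult)
    moreover define c where "c = 1 / ln \<epsilon>"
    moreover have "c * y \<le> c * x + e" if "x \<le> ln K + y" for x y
      using mult_left_mono_neg[OF that, of c] neg small unfolding c_def[symmetric]
      by (simp add: algebra_simps)
    ultimately show ?case
      using neg unfolding c_def[symmetric]
      by (cases "ennreal_ln (I \<epsilon>)"; cases "ennreal_ln (J \<epsilon>)") auto
  qed
qed

text \<open>An error below every \<open>e > 0\<close> is invisible to the lower and upper limits.\<close>

lemma Liminf_Limsup_le_of_eventually_le_add: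
  fixes u v :: "'b \<Rightarrow> ereal"
  assumes F: "F \<noteq> bot" and le: "\<And>e. e > 0 \<Longrightarrow> \<forall>\<^sub>F x in F. u x \<le> v x + ereal e"
  shows "Liminf F u \<le> Liminf F v" and "Limsup F u \<le> Limsup F v"
proof -
  show "Liminf F u \<le> Liminf F v"
  proof (rule ereal_le_epsilon2)
    fix e :: real assume "e > 0"
    then have "Liminf F u \<le> Liminf F (\<lambda>x. v x + ereal e)"
      by (intro Liminf_mono le)
    also have "\<dots> = Liminf F v + ereal e"
      using F by (intro Liminf_add_ereal_right) auto
    finally show "Liminf F u \<le> Liminf F v + ereal e" .
  qed
  show "Limsup F u \<le> Limsup F v"
  proof (rule ereal_le_epsilon2)
    fix e :: real assume "e > 0"
    then have "Limsup F u \<le> Limsup F (\<lambda>x. v x + ereal e)"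
      by (intro Limsup_mono le)
    also have "\<dots> = Limsup F v + ereal e"
      using F by (intro Limsup_add_ereal_right) auto
    finally show "Limsup F u \<le> Limsup F v + ereal e" .
  qed
qed

theorem dims_eq_of_comparable:
  assumes fin: "finite_measure M" "finite_measure N" and sets: "sets M = sets N" and C: "C > 0"
    and MN: "\<And>B. B \<in> sets N \<Longrightarrow> emeasure M B \<le> ennreal C * emeasure N B"
    and NM: "\<And>B. B \<in> sets N \<Longrightarrow> emeasure N B \<le> ennreal C * emeasure M B"
  shows "lower_dim \<rho> q M = lower_dim \<rho> q N" and "upper_dim \<rho> q M = upper_dim \<rho> q N"
proof -
  define K where "K = C * C powr \<bar>q - 1\<bar>"
  have K: "K > 0" using C by (simp add: K_def)
  have IM: "correlation_integral \<rho> q M \<epsilon> \<le> ennreal K * correlation_integral \<rho> q N \<epsilon>" for \<epsilon>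
    unfolding K_def using fin sets C MN NM by (rule correlation_integral_le_of_comparable)
  have IN: "correlation_integral \<rho> q N \<epsilon> \<le> ennreal K * correlation_integral \<rho> q M \<epsilon>" for \<epsilon>
    unfolding K_def using fin(2,1) sets[symmetric] C NM MN
    by (rule correlation_integral_le_of_comparable) (simp_all add: sets)
  note le = Liminf_Limsup_le_of_eventually_le_add[OF trivial_limit_at_right_real
      log_ratio_le_of_le_mult[OF K]]
  show "lower_dim \<rho> q M = lower_dim \<rho> q N"
    unfolding lower_dim_def by (intro arg_cong2[where f = "(*)"] refl antisym le IM IN)
  show "upper_dim \<rho> q M = upper_dim \<rho> q N"
    unfolding upper_dim_def by (intro arg_cong2[where f = "(*)"] refl antisym le IM IN)
qed

section \<open>Time reparameterizations\<close>

text \<open>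
  The mean of \<open>r\<close> lies in \<open>[a, b]\<close> together with \<open>r\<close>, so the density takes values in
  \<open>[a/b, b/a]\<close>.
\<close>

lemma reparam_measure_comparable:
  assumes "prob_space M" and r: "r \<in> borel_measurable M"
    and a: "a > 0" and bounds: "\<And>x. a \<le> r x \<and> r x \<le> b" and B: "B \<in> sets M"
  shows "emeasure (reparam_measure r M) B \<le> ennreal (b / a) * emeasure M B"
    and "emeasure M B \<le> ennreal (b / a) * emeasure (reparam_measure r M) B"
proof -
  interpret prob_space M by fact
  define R where "R = (\<integral>y. r y \<partial>M)"
  have b: "b > 0" using a bounds[of undefined] by linarith
  have "\<bar>r x\<bar> \<le> b" for x
    using bounds[of x] a by simp
  then have int: "integrable M r"
    using r by (intro integrable_const_bound[where B = b]) auto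
  have R: "a \<le> R" "R \<le> b"
    unfolding R_def using int bounds by (auto intro!: integral_ge_const integral_le_const)
  note [measurable] = r B
  have eq: "emeasure (reparam_measure r M) B = (\<integral>\<^sup>+x. ennreal (r x / R) * indicator B x \<partial>M)"
    unfolding reparam_measure_def R_def[symmetric] by (intro emeasure_density) measurable
  have up: "r x / R \<le> b / a" and low: "1 \<le> b / a * (r x / R)" for x
  proof -
    show "r x / R \<le> b / a"
      using bounds[of x] R a b by (intro frac_le) auto
    have "a * R \<le> r x * b"
      using bounds[of x] R a b by (intro mult_mono) auto
    then show "1 \<le> b / a * (r x / R)"
      using R a by (simp add: field_simps)
  qed
  show "emeasure (reparam_measure r M) B \<le> ennreal (b / a) * emeasure M B"
    unfolding eq nn_integral_cmult_indicator[OF B, symmetric]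
    using up by (intro nn_integral_mono mult_right_mono ennreal_leI) auto
  have "emeasure M B = (\<integral>\<^sup>+x. indicator B x \<partial>M)" using B by simp
  also have "\<dots> \<le> (\<integral>\<^sup>+x. ennreal (b / a) * (ennreal (r x / R) * indicator B x) \<partial>M)"
  proof (rule nn_integral_mono)
    fix x
    have "1 \<le> ennreal (b / a) * ennreal (r x / R)"
      using low[of x] a b R bounds[of x] by (subst ennreal_mult[symmetric]) auto
    then show "indicator B x \<le> ennreal (b / a) * (ennreal (r x / R) * indicator B x)"
      by (auto simp: indicator_def)
  qed
  also have "\<dots> = ennreal (b / a) * emeasure (reparam_measure r M) B"
    unfolding eq by (intro nn_integral_cmult) measurable
  finally show "emeasure M B \<le> ennreal (b / a) * emeasure (reparam_measure r M) B" .
qed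

theorem theorem8:
  fixes A :: "('a::{t2_space,second_countable_topology}, 'e::euclidean_space) chart set"
    and G :: "('a, 'e) chart \<Rightarrow> 'a \<Rightarrow> 'e \<Rightarrow> 'e \<Rightarrow> real"
    and f :: "('a, 'e) chart \<Rightarrow> 'a \<Rightarrow> 'e"
    and \<phi> \<phi>\<^sub>r :: "real \<Rightarrow> 'a \<Rightarrow> 'a"
    and r :: "'a \<Rightarrow> real"
    and \<mu> :: "'a measure"
    and m l :: nat
    and q :: real
  assumes "m \<ge> 2" and "1 \<le> l" and "l < m"
    and "Ck_manifold m A"
    and "Ck_riemannian_metric (m - 1) A G"
    and "Ck_vector_field l A f"
    and "Ck_flow l A \<phi>" and "generates_flow A f \<phi>"
    and "time_reparameterization l A \<phi> r \<phi>\<^sub>r"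
    and "r \<in> borel_measurable borel"
    and "\<exists>a>0. \<exists>b. \<forall>x. a \<le> r x \<and> r x \<le> b"
    and "\<mu> \<in> invariant_prob_measures \<phi>"
    and "q > 0" and "q \<noteq> 1"
  shows "lower_dim (riemannian_dist A G) q (reparam_measure r \<mu>) =
           lower_dim (riemannian_dist A G) q \<mu> \<and>
         upper_dim (riemannian_dist A G) q (reparam_measure r \<mu>) =
           upper_dim (riemannian_dist A G) q \<mu>"
proof -
  from assms obtain a b where a: "a > 0" and bounds: "\<And>x. a \<le> r x \<and> r x \<le> b"
    by blast
  have sets: "sets \<mu> = sets borel" and prob: "prob_space \<mu>"
    using assms by (auto simp: invariant_prob_measures_def)
  interpret prob_space \<mu> by (fact prob)
  have r: "r \<in> borel_measurable \<mu>"
    using assms measurable_cong_sets[OF sets refl] by auto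
  have C: "b / a > 0"
    using a bounds[of undefined] by simp
  note comparable = reparam_measure_comparable[OF prob r a bounds]
  have sets_r: "sets (reparam_measure r \<mu>) = sets \<mu>"
    by (simp add: reparam_measure_def)
  have fin: "finite_measure (reparam_measure r \<mu>)"
  proof
    have "emeasure (reparam_measure r \<mu>) (space \<mu>) \<le> ennreal (b / a) * emeasure \<mu> (space \<mu>)"
      by (rule comparable) simp
    then show "emeasure (reparam_measure r \<mu>) (space (reparam_measure r \<mu>)) \<noteq> \<infinity>"
      using sets_eq_imp_space_eq[OF sets_r] by (auto simp: emeasure_space_1 top_unique)
  qed
  show ?thesis
    using dims_eq_of_comparable[OF fin finite_measure_axioms sets_r C comparable] by blast
qed

end
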